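(* Let $s,t$ be real numbers, let $\alpha=\min\{s,t\}$ and let $c\in(-\alpha,\infty)$. For $x\in(-\alpha,\infty)$ define $$g_{s,t}(x)=\begin{cases}\displaystyle\frac1{t-s}\int_c^x\ln\left[\frac{\Gamma(u+t)}{\Gamma(u+s)}\cdot\frac{\Gamma(c+s)}{\Gamma(c+t)}\right]du,& s\ne t,\\[1em]\displaystyle\int_c^x[\psi(u+s)-\psi(c+s)]\,du,& s=t,\end{cases}$$ and $$f_{s,t}(x)=\begin{cases}\displaystyle\frac{g_{s,t}(x)}{[g'_{s,t}(x)-1]\exp[g'_{s,t}(x)]+1},& x\ne c,\\[1em]\dfrac{1}{g''_{s,t}(c)},& x=c.\end{cases}$$ Then the function $f_{s,t}$ is decreasing on $(-\alpha,\infty)$ if $|s-t|<1$, and increasing on $(-\alpha,\infty)$ if $|s-t|>1$.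
   Context: $\Gamma(x)=\int_0^\infty v^{x-1}e^{-v}\,dv$ for $x>0$ is the Euler gamma function and $\psi(x)=\Gamma'(x)/\Gamma(x)$ is the psi (digamma) function on $(0,\infty)$. Primes denote derivatives with respect to $x$, and $\int_c^x$ is the oriented integral (so $\int_c^x=-\int_x^c$ when $x<c$). *)

theory Defs
  imports "HOL-Analysis.Analysis"
begin

text \<open>The interval integral \<open>LBINT u=c..x\<close> is oriented: it changes sign when the bounds are
  swapped, so no assumption \<open>c \<le> x\<close> is needed.\<close>

definition g_fun :: "real \<Rightarrow> real \<Rightarrow> real \<Rightarrow> real \<Rightarrow> real" where
  "g_fun s t c x =
     (if s \<noteq> t
      then 1 / (t - s) *
             (LBINT u=c..x. ln (Gamma (u + t) / Gamma (u + s) * (Gamma (c + s) / Gamma (c + t))))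
      else (LBINT u=c..x. (Digamma (u + s) - Digamma (c + s))))"

definition f_fun :: "real \<Rightarrow> real \<Rightarrow> real \<Rightarrow> real \<Rightarrow> real" where
  "f_fun s t c x =
     (let g = g_fun s t c in
      if x \<noteq> c then g x / ((deriv g x - 1) * exp (deriv g x) + 1)
      else 1 / deriv (deriv g) c)"

end

theory Submission
  imports Defs
begin

text \<open>Write \<open>\<phi> = g'\<close> and \<open>D = \<phi>'\<close>, a divided difference of the digamma function. The denominator of
  \<open>f\<close> vanishes at \<open>c\<close>, as \<open>g\<close> does, and has derivative \<open>D e\<^sup>\<phi> \<cdot> \<phi>\<close>, so by the monotone form of
  l'Hopital's rule \<open>f\<close> inherits the monotonicity of \<open>1 / (D e\<^sup>\<phi>)\<close>. As \<open>(D e\<^sup>\<phi>)' = (D\<^sup>2 + D') e\<^sup>\<phi>\<close>,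
  everything rests on the sign of \<open>\<Delta> = D\<^sup>2 + D'\<close>. Two applications of the functional equation give
  it: with \<open>p x = 1 / ((x + s) (x + t))\<close> one has \<open>\<Delta> x - \<Delta> (x + 1) = p x \<cdot> E x\<close>, where
  \<open>E x = 2 D x - p x (2 x + s + t + 1)\<close>, and
  \<open>E x - E (x + 1) = p x \<cdot> p (x + 1) \<cdot> (1 - (s - t)\<^sup>2)\<close>. Both \<open>E\<close> and \<open>\<Delta>\<close> vanish at infinity.\<close>

section \<open>Monotone form of l'Hopital's rule\<close>

text \<open>For a constant k, f - k g vanishes at c and has derivative (r - k) g'. A bound of r by k
  between c and x therefore becomes a bound of f x by k g x. Taking k = r x gives the sign of the
  derivative of f / g off c, and k = r c compares the two sides of c.\<close>

lemma antimono_on_quotient: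
  fixes f g g' r :: "real \<Rightarrow> real"
  assumes I: "is_interval I" "c \<in> I"
    and df: "\<And>x. x \<in> I \<Longrightarrow> (f has_real_derivative r x * g' x) (at x)"
    and dg: "\<And>x. x \<in> I \<Longrightarrow> (g has_real_derivative g' x) (at x)"
    and zero: "f c = 0" "g c = 0"
    and pos: "\<And>x. x \<in> I \<Longrightarrow> c < x \<Longrightarrow> 0 < g' x"
    and neg: "\<And>x. x \<in> I \<Longrightarrow> x < c \<Longrightarrow> g' x < 0"
    and r: "antimono_on I r"
  shows "antimono_on I (\<lambda>x. if x = c then r c else f x / g x)"
proof -
  have between: "z \<in> I" if "x \<in> I" "y \<in> I" "x \<le> z" "z \<le> y" for x y z
    using mem_is_interval_1_I[OF I(1) that] .
  have rle: "r y \<le> r x" if "x \<in> I" "y \<in> I" "x \<le> y" for x y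
    using r that by (auto dest: monotone_onD)
  have dk: "((\<lambda>x. f x - k * g x) has_real_derivative (r x - k) * g' x) (at x)" if "x \<in> I" for k x
    using DERIV_diff[OF df[OF that] DERIV_cmult[OF dg[OF that], of k]]
    by (simp add: left_diff_distrib)
  have cg: "continuous_on {x..y} g" if "x \<in> I" "y \<in> I" for x y
    using DERIV_isCont[OF dg] between[OF that] by (intro continuous_at_imp_continuous_on) auto
  have ck: "continuous_on {x..y} (\<lambda>x. f x - k * g x)" if "x \<in> I" "y \<in> I" for x y k
    using DERIV_isCont[OF dk] between[OF that] by (intro continuous_at_imp_continuous_on) auto
  \<comment> \<open>The sign change of g' makes 0 = g c a strict minimum.\<close>
  have gpos: "0 < g x" if "x \<in> I" "x \<noteq> c" for x
  proof (cases "c < x")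
    case True
    have "g c < g x"
    proof (rule DERIV_pos_imp_increasing_open[OF True])
      fix u assume u: "c < u" "u < x"
      then have "u \<in> I" using between[OF I(2) that(1)] by simp
      then show "\<exists>y. (g has_real_derivative y) (at u) \<and> 0 < y"
        using dg pos u by blast
    qed (rule cg[OF I(2) that(1)])
    then show ?thesis using zero by simp
  next
    case False
    then have "x < c" using that by simp
    then have "g c < g x"
    proof (rule DERIV_neg_imp_decreasing_open)
      fix u assume u: "x < u" "u < c"
      then have "u \<in> I" using between[OF that(1) I(2)] by simp
      then show "\<exists>y. (g has_real_derivative y) (at u) \<and> y < 0"
        using dg neg u by blast
    qed (rule cg[OF that(1) I(2)])
    then show ?thesis using zero by simp
  qed
  \<comment> \<open>Of the four comparisons, those left of c have the same direction as those right
    of c: g' < 0 reverses the monotonicity of f - k g, but c is now the right endpoint.\<close>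
  have right_ge: "k * g x \<le> f x" if "x \<in> I" "c < x" and k: "\<And>u. u \<in> I \<Longrightarrow> c < u \<Longrightarrow> u < x \<Longrightarrow> k \<le> r u" for x k
  proof -
    have "f c - k * g c \<le> f x - k * g x"
    proof (rule DERIV_nonneg_imp_increasing_open[where f = "\<lambda>x. f x - k * g x"])
      fix u assume u: "c < u" "u < x"
      then have "u \<in> I" using between[OF I(2) that(1)] by simp
      then show "\<exists>y. ((\<lambda>x. f x - k * g x) has_real_derivative y) (at u) \<and> 0 \<le> y"
        using dk[of u k] k[of u] pos[of u] u by (intro exI conjI) auto
    qed (use that ck I in auto)
    then show ?thesis using zero by simp
  qed
  have right_le: "f x \<le> k * g x" if "x \<in> I" "c < x" and k: "\<And>u. u \<in> I \<Longrightarrow> c < u \<Longrightarrow> u < x \<Longrightarrow> r u \<le> k" for x k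
  proof -
    have "f c - k * g c \<ge> f x - k * g x"
    proof (rule DERIV_nonpos_imp_decreasing_open[where f = "\<lambda>x. f x - k * g x"])
      fix u assume u: "c < u" "u < x"
      then have "u \<in> I" using between[OF I(2) that(1)] by simp
      then show "\<exists>y. ((\<lambda>x. f x - k * g x) has_real_derivative y) (at u) \<and> y \<le> 0"
        using dk[of u k] k[of u] pos[of u] u by (intro exI conjI) (auto simp: mult_le_0_iff)
    qed (use that ck I in auto)
    then show ?thesis using zero by simp
  qed
  have left_le: "f x \<le> k * g x" if "x \<in> I" "x < c" and k: "\<And>u. u \<in> I \<Longrightarrow> x < u \<Longrightarrow> u < c \<Longrightarrow> r u \<le> k" for x k
  proof -
    have "f x - k * g x \<le> f c - k * g c"
    proof (rule DERIV_nonneg_imp_increasing_open[where f = "\<lambda>x. f x - k * g x"])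
      fix u assume u: "x < u" "u < c"
      then have "u \<in> I" using between[OF that(1) I(2)] by simp
      then show "\<exists>y. ((\<lambda>x. f x - k * g x) has_real_derivative y) (at u) \<and> 0 \<le> y"
        using dk[of u k] k[of u] neg[of u] u by (intro exI conjI) (auto simp: zero_le_mult_iff)
    qed (use that ck I in auto)
    then show ?thesis using zero by simp
  qed
  have left_ge: "k * g x \<le> f x" if "x \<in> I" "x < c" and k: "\<And>u. u \<in> I \<Longrightarrow> x < u \<Longrightarrow> u < c \<Longrightarrow> k \<le> r u" for x k
  proof -
    have "f x - k * g x \<ge> f c - k * g c"
    proof (rule DERIV_nonpos_imp_decreasing_open[where f = "\<lambda>x. f x - k * g x"])
      fix u assume u: "x < u" "u < c"
      then have "u \<in> I" using between[OF that(1) I(2)] by simp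
      then show "\<exists>y. ((\<lambda>x. f x - k * g x) has_real_derivative y) (at u) \<and> y \<le> 0"
        using dk[of u k] k[of u] neg[of u] u by (intro exI conjI) (auto simp: mult_le_0_iff)
    qed (use that ck I in auto)
    then show ?thesis using zero by simp
  qed
  \<comment> \<open>Since r is decreasing, the comparisons with k = r x show that r g - f is \<le> 0
    right of c and \<ge> 0 left of c. It changes sign together with g', so the derivative is \<le> 0
    on both sides.\<close>
  have dq: "((\<lambda>x. f x / g x) has_real_derivative g' x * (r x * g x - f x) / (g x)\<^sup>2) (at x)"
    if "x \<in> I" "x \<noteq> c" for x
    using DERIV_divide[OF df[OF that(1)] dg[OF that(1)]] gpos[OF that]
    by (simp add: power2_eq_square algebra_simps)
  have dq_le: "g' x * (r x * g x - f x) / (g x)\<^sup>2 \<le> 0" if "x \<in> I" "x \<noteq> c" for x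
  proof (cases "c < x")
    case True
    have "r x * g x \<le> f x" using that True rle by (intro right_ge) auto
    then show ?thesis using pos[OF that(1) True]
      by (intro divide_nonpos_nonneg mult_nonneg_nonpos) auto
  next
    case False
    then have "x < c" using that by simp
    moreover have "f x \<le> r x * g x" using that \<open>x < c\<close> rle by (intro left_le) auto
    ultimately show ?thesis using neg[OF that(1)]
      by (intro divide_nonpos_nonneg mult_nonpos_nonneg) auto
  qed
  have same: "f y / g y \<le> f x / g x" if "x \<in> I" "y \<in> I" "x \<le> y" "y < c \<or> c < x" for x y
  proof (rule DERIV_nonpos_imp_nonincreasing[OF that(3)])
    fix u assume u: "x \<le> u" "u \<le> y"
    then have "u \<in> I" "u \<noteq> c" using between[OF that(1,2)] that(4) by auto
    then show "\<exists>z. ((\<lambda>x. f x / g x) has_real_derivative z) (at u) \<and> z \<le> 0"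
      using dq dq_le by blast
  qed
  have right: "f x / g x \<le> r c" if "x \<in> I" "c < x" for x
    using right_le[OF that, of "r c"] gpos[of x] rle[OF I(2)] that by (simp add: divide_le_eq)
  have left: "r c \<le> f x / g x" if "x \<in> I" "x < c" for x
    using left_ge[OF that, of "r c"] gpos[of x] rle[OF _ I(2)] that by (simp add: le_divide_eq)
  show ?thesis
  proof (rule monotone_onI)
    fix x y assume xy: "x \<in> I" "y \<in> I" "x \<le> y"
    show "(if y = c then r c else f y / g y) \<le> (if x = c then r c else f x / g x)"
    \<comment> \<open>Points on one side of c are compared by the derivative; otherwise x \<le> c
      \<le> y, and r c separates the two values.\<close>
    proof (cases "y < c \<or> c < x")
      case True
      then show ?thesis using same[OF xy] xy by auto
    next
      case False
      then show ?thesis using right[OF xy(2)] left[OF xy(1)] by (cases "x = c"; cases "y = c") auto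
    qed
  qed
qed

section \<open>Divided differences of polygamma functions\<close>

text \<open>The mean value theorem on [y - 1, y] and the functional equation give the exact value of
  \<open>Polygamma (Suc n)\<close> at some z < y. Its absolute value decreases on the positive axis,
  so the value at y is smaller; sign and direction of monotonicity depend on the parity of
  n.\<close>

lemma abs_Polygamma_Suc_le:
  fixes y :: real
  assumes "1 < y"
  shows "\<bar>Polygamma (Suc n) y\<bar> \<le> fact n / (y - 1) ^ Suc n"
proof -
  have "\<exists>z. y - 1 < z \<and> z < y \<and>
      Polygamma n y - Polygamma n (y - 1) = (y - (y - 1)) * Polygamma (Suc n) z"
    using assms by (intro MVT2 derivative_intros) (auto elim!: nonpos_Ints_cases)
  then obtain z where z: "y - 1 < z" "z < y"
    and eq: "Polygamma n y - Polygamma n (y - 1) = Polygamma (Suc n) z" by auto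
  have eq': "Polygamma (Suc n) z = (-1) ^ n * (fact n / (y - 1) ^ Suc n)"
    using Polygamma_plus1[of "y - 1" n] assms eq by simp
  show ?thesis
  proof (cases "even n")
    case True
    then have "0 < Polygamma (Suc n) y"
      using assms by (intro Polygamma_real_odd_pos) (auto elim!: nonpos_Ints_cases)
    moreover have "Polygamma (Suc n) y < Polygamma (Suc n) z"
      using True assms z by (intro Polygamma_real_strict_antimono) auto
    ultimately show ?thesis using eq' True by simp
  next
    case False
    then have "Polygamma (Suc n) y < 0"
      using assms by (intro Polygamma_real_even_neg) auto
    moreover have "Polygamma (Suc n) z < Polygamma (Suc n) y"
      using False assms z by (intro Polygamma_real_strict_mono) auto
    ultimately show ?thesis using eq' False by simp
  qed
qed

text \<open>The case s = t is the confluent divided difference, so both cases of g are treated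
  together: n = 0 gives g'', and differentiation in x raises n by one.\<close>

definition dd_Polygamma :: "nat \<Rightarrow> real \<Rightarrow> real \<Rightarrow> real \<Rightarrow> real" where
  "dd_Polygamma n s t x =
    (if s = t then Polygamma (Suc n) (x + s)
     else (Polygamma n (x + t) - Polygamma n (x + s)) / (t - s))"

lemma dd_Polygamma_commute: "dd_Polygamma n s t = dd_Polygamma n t s"
  by (auto simp: dd_Polygamma_def fun_eq_iff divide_simps) (auto simp: algebra_simps)

text \<open>This transfers sign and decay from \<open>Polygamma (Suc n)\<close> to the divided
  difference; for both a lower bound on z suffices.\<close>

lemma dd_Polygamma_MVT:
  assumes "- min s t < x"
  obtains z where "x + min s t \<le> z" "dd_Polygamma n s t x = Polygamma (Suc n) z"
proof -
  have less: "\<exists>z. x + min s t \<le> z \<and> dd_Polygamma n s t x = Polygamma (Suc n) z"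
    if "s < t" "- min s t < x" for s t
  proof -
    have "\<exists>z. x + s < z \<and> z < x + t \<and>
        Polygamma n (x + t) - Polygamma n (x + s) = (x + t - (x + s)) * Polygamma (Suc n) z"
      using that by (intro MVT2 derivative_intros) (auto elim!: nonpos_Ints_cases)
    then obtain z where "x + s < z"
      "Polygamma n (x + t) - Polygamma n (x + s) = (t - s) * Polygamma (Suc n) z" by auto
    then show ?thesis using that by (intro exI[of _ z]) (auto simp: dd_Polygamma_def)
  qed
  consider "s < t" | "t < s" | "s = t" by linarith
  then show ?thesis
  proof cases
    case 1
    then show ?thesis using less[of s t] assms that by blast
  next
    case 2
    then show ?thesis
      using less[of t s] assms that by (metis dd_Polygamma_commute min.commute)
  next
    case 3
    then show ?thesis using that[of "x + s"] by (simp add: dd_Polygamma_def)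
  qed
qed

lemma has_real_derivative_dd_Polygamma:
  assumes "- min s t < x"
  shows "(dd_Polygamma n s t has_real_derivative dd_Polygamma (Suc n) s t x) (at x)"
proof -
  have "x + s \<notin> \<int>\<^sub>\<le>\<^sub>0" "x + t \<notin> \<int>\<^sub>\<le>\<^sub>0" using assms by (auto elim!: nonpos_Ints_cases)
  then show ?thesis
    unfolding dd_Polygamma_def by (cases "s = t") (auto intro!: derivative_eq_intros)
qed

lemma dd_Digamma_pos:
  assumes "- min s t < x"
  shows "0 < dd_Polygamma 0 s t x"
proof -
  obtain z where z: "x + min s t \<le> z" "dd_Polygamma 0 s t x = Polygamma (Suc 0) z"
    using dd_Polygamma_MVT[OF assms] .
  have "0 < Polygamma (Suc 0) z"
    using z(1) assms by (intro Polygamma_real_odd_pos) (auto elim!: nonpos_Ints_cases)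
  then show ?thesis using z by simp
qed

lemma dd_Polygamma_tendsto_0: "(dd_Polygamma n s t \<longlongrightarrow> 0) at_top"
proof (rule Lim_null_comparison)
  have "\<forall>\<^sub>F x in at_top. x > 1 - min s t" by (rule eventually_gt_at_top)
  then show "\<forall>\<^sub>F x in at_top. norm (dd_Polygamma n s t x) \<le> fact n / (x + min s t - 1) ^ Suc n"
  proof eventually_elim
    case (elim x)
    then have "- min s t < x" by simp
    then obtain z where z: "x + min s t \<le> z" "dd_Polygamma n s t x = Polygamma (Suc n) z"
      by (rule dd_Polygamma_MVT)
    have "\<bar>Polygamma (Suc n) z\<bar> \<le> fact n / (z - 1) ^ Suc n"
      using elim z by (intro abs_Polygamma_Suc_le) simp
    also have "\<dots> \<le> fact n / (x + min s t - 1) ^ Suc n"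
      using elim z(1) by (intro divide_left_mono power_mono mult_pos_pos zero_less_power) auto
    finally show ?case using z by simp
  qed
  have "filterlim (\<lambda>x. x + (min s t - 1)) at_top at_top"
    by (intro filterlim_tendsto_add_at_top[OF tendsto_const filterlim_ident, simplified add.commute])
  then have "filterlim (\<lambda>x. (x + min s t - 1) ^ Suc n) at_top at_top"
    by (intro filterlim_pow_at_top) (simp_all add: algebra_simps)
  then show "((\<lambda>x. fact n / (x + min s t - 1) ^ Suc n) \<longlongrightarrow> 0) at_top"
    by (intro tendsto_divide_0[OF tendsto_const] filterlim_at_top_imp_at_infinity)
qed

section \<open>Functional equations under the shift by one\<close>

text \<open>The increment 1 / (x + t) - 1 / (x + s) contains the factor t - s, which cancels the
  denominator of the divided difference and leaves a formula valid also for s = t.\<close>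

lemma dd_Digamma_plus1:
  assumes "- min s t < x"
  shows "dd_Polygamma 0 s t (x + 1) = dd_Polygamma 0 s t x - 1 / ((x + s) * (x + t))"
proof -
  have xs: "x + s \<noteq> 0" and xt: "x + t \<noteq> 0" using assms by auto
  have plus1: "Polygamma n (x + 1 + a) = Polygamma n (x + a) + (-1) ^ n * fact n / (x + a) ^ Suc n"
    if "x + a \<noteq> 0" for a n
    using Polygamma_plus1[OF that, of n] by (simp add: add_ac)
  show ?thesis
  proof (cases "s = t")
    case True
    then show ?thesis using plus1[OF xt, of 1] by (simp add: dd_Polygamma_def power2_eq_square)
  next
    case False
    define p where "p = 1 / ((x + s) * (x + t))"
    have "1 / (x + t) - 1 / (x + s) = - (t - s) * p"
      using xs xt by (simp add: p_def field_simps)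
    moreover have "Digamma (x + 1 + t) = Digamma (x + t) + 1 / (x + t)"
      "Digamma (x + 1 + s) = Digamma (x + s) + 1 / (x + s)"
      using plus1[OF xt, of 0] plus1[OF xs, of 0] by simp_all
    ultimately have "Digamma (x + 1 + t) - Digamma (x + 1 + s) =
        Digamma (x + t) - Digamma (x + s) - (t - s) * p"
      by linarith
    then show ?thesis using False
      by (simp add: dd_Polygamma_def diff_divide_distrib[of _ "(t - s) * p"] p_def[symmetric])
  qed
qed

text \<open>This is the derivative of the previous functional equation: both sides differentiate the
  same function at x.\<close>

lemma dd_Trigamma_plus1:
  assumes "- min s t < x"
  shows "dd_Polygamma 1 s t (x + 1) =
    dd_Polygamma 1 s t x + (2 * x + s + t) / ((x + s) * (x + t))\<^sup>2"
proof (rule DERIV_unique)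
  let ?D = "dd_Polygamma 0 s t"
  have "((\<lambda>y. ?D (y + 1)) has_real_derivative dd_Polygamma 1 s t (x + 1)) (at x)"
    using has_real_derivative_dd_Polygamma[of s t "x + 1" 0] assms
    by (subst DERIV_shift[symmetric]) simp
  then show "((\<lambda>y. ?D y - 1 / ((y + s) * (y + t))) has_real_derivative
      dd_Polygamma 1 s t (x + 1)) (at x)"
    by (rule has_field_derivative_transform_within_open[where S = "{- min s t<..}"])
      (use assms dd_Digamma_plus1 in auto)
  show "((\<lambda>y. ?D y - 1 / ((y + s) * (y + t))) has_real_derivative
      dd_Polygamma 1 s t x + (2 * x + s + t) / ((x + s) * (x + t))\<^sup>2) (at x)"
  proof -
    have "((\<lambda>y. 1 / ((y + s) * (y + t))) has_real_derivative
        - ((2 * x + s + t) / ((x + s) * (x + t))\<^sup>2)) (at x)"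
      using assms by (auto intro!: derivative_eq_intros simp: power2_eq_square minus_divide_left)
    from DERIV_diff[OF has_real_derivative_dd_Polygamma[OF assms, of 0] this]
    show ?thesis by simp
  qed
qed

section \<open>The sign of \<Delta>\<close>

text \<open>Along x, x + 1, x + 2, ... the values decrease to 0, so the first one is \<ge>
  0.\<close>

lemma nonneg_if_decreasing_shift:
  fixes h :: "real \<Rightarrow> real"
  assumes "\<And>y. x \<le> y \<Longrightarrow> h (y + 1) \<le> h y" and lim: "(h \<longlongrightarrow> 0) at_top"
  shows "0 \<le> h x"
proof (rule decseq_ge[where X = "\<lambda>n. h (x + real n)" and n = 0, simplified])
  show "decseq (\<lambda>n. h (x + real n))"
    using assms(1)[of "x + real n" for n] by (intro decseq_SucI) (simp add: add_ac)
  have "filterlim (\<lambda>n. x + real n) at_top sequentially"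
    by (intro filterlim_tendsto_add_at_top[OF tendsto_const] filterlim_real_sequentially)
  then show "(\<lambda>n. h (x + real n)) \<longlonglongrightarrow> 0"
    by (rule filterlim_compose[OF lim])
qed

text \<open>The multiplier e lets one argument yield either sign. The shift lemma is applied first
  to e E, then to e \<Delta>.\<close>

lemma dd_Digamma_sq_plus_deriv_sign:
  fixes e :: real
  assumes x: "- min s t < x" and e: "0 \<le> e * (1 - (s - t)\<^sup>2)"
  shows "0 \<le> e * ((dd_Polygamma 0 s t x)\<^sup>2 + dd_Polygamma 1 s t x)"
proof -
  define D where "D = dd_Polygamma 0 s t"
  define D' where "D' = dd_Polygamma 1 s t"
  define p where "p y = 1 / ((y + s) * (y + t))" for y
  define E where "E y = 2 * D y - p y * (2 * y + s + t + 1)" for y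
  define \<Delta> where "\<Delta> y = (D y)\<^sup>2 + D' y" for y
  have ppos: "0 < p y" if "- min s t < y" for y
    using that by (auto simp: p_def)
  have limD: "(D \<longlongrightarrow> 0) at_top" "(D' \<longlongrightarrow> 0) at_top"
    unfolding D_def D'_def by (rule dd_Polygamma_tendsto_0)+
  have lin: "((\<lambda>y. 1 / (y + a)) \<longlongrightarrow> 0) at_top" for a :: real
    by (intro tendsto_divide_0[OF tendsto_const] filterlim_at_top_imp_at_infinity
        filterlim_tendsto_add_at_top[OF tendsto_const filterlim_ident, simplified add.commute])
  have E_nonneg: "0 \<le> e * E y" if y: "- min s t < y" for y
  proof (rule nonneg_if_decreasing_shift[where h = "\<lambda>y. e * E y"])
    fix z assume "y \<le> z"
    then have z: "- min s t < z" using y by simp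
    have nz: "z + s \<noteq> 0" "z + t \<noteq> 0" "z + s + 1 \<noteq> 0" "z + t + 1 \<noteq> 0" using z by auto
    have p1: "p (z + 1) = 1 / ((z + s + 1) * (z + t + 1))" by (simp add: p_def add_ac)
    have "D z - D (z + 1) = p z"
      using dd_Digamma_plus1[OF z] by (simp add: D_def p_def)
    then have "E z - E (z + 1) = 2 * p z - p z * (2 * z + s + t + 1)
        + p (z + 1) * (2 * z + s + t + 3)"
      by (simp add: E_def algebra_simps)
    \<comment> \<open>With S = A + B and P = A B, clearing denominators leaves (1 - S) (1 + S + P) +
      (S + 3) P = 1 + 4 P - S^2 = 1 - (A - B)^2. This is the source of the threshold 1 for |s -
      t|.\<close>
    also have "\<dots> = p z * p (z + 1) * (1 - (s - t)\<^sup>2)"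
    proof -
      define A B where "A = z + s" and "B = z + t"
      have eqs: "2 * z + s + t = A + B" "s - t = A - B" by (auto simp: A_def B_def)
      have nz: "A \<noteq> 0" "B \<noteq> 0" "A + 1 \<noteq> 0" "B + 1 \<noteq> 0" using nz by (auto simp: A_def B_def)
      show ?thesis unfolding eqs p1 unfolding p_def A_def[symmetric] B_def[symmetric]
        using nz by (simp add: divide_simps) algebra
    qed
    finally have "e * (E z - E (z + 1)) = (p z * p (z + 1)) * (e * (1 - (s - t)\<^sup>2))"
      by simp
    moreover have "0 \<le> (p z * p (z + 1)) * (e * (1 - (s - t)\<^sup>2))"
      using e ppos[of z] ppos[of "z + 1"] z
      by (intro mult_nonneg_nonneg[OF mult_nonneg_nonneg e]) auto
    ultimately show "e * E (z + 1) \<le> e * E z" by (simp add: right_diff_distrib)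
  next
    \<comment> \<open>Partial fractions of \<open>p y * (2 * y + s + t + 1)\<close>, with numerator
      (y + s) + (y + t) + 1, make each term visibly tend to 0.\<close>
    have "((\<lambda>y. 2 * D y - (1 / (y + t) + 1 / (y + s) + 1 / (y + s) * (1 / (y + t)))) \<longlongrightarrow>
        2 * 0 - (0 + 0 + 0 * 0)) at_top"
      by (intro tendsto_intros limD lin)
    then have "(E \<longlongrightarrow> 2 * 0 - (0 + 0 + 0 * 0)) at_top"
    proof (rule Lim_transform_eventually)
      show "\<forall>\<^sub>F y in at_top.
          2 * D y - (1 / (y + t) + 1 / (y + s) + 1 / (y + s) * (1 / (y + t))) = E y"
        using eventually_gt_at_top[of "- min s t"]
      proof eventually_elim
        case (elim y)
        then have "y + s \<noteq> 0" "y + t \<noteq> 0" by auto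
        then show ?case by (simp add: E_def p_def divide_simps)
      qed
    qed
    then show "((\<lambda>y. e * E y) \<longlongrightarrow> 0) at_top"
      using tendsto_mult_right_zero by simp
  qed
  have "0 \<le> e * \<Delta> x"
  proof (rule nonneg_if_decreasing_shift[where h = "\<lambda>y. e * \<Delta> y"])
    fix y assume "x \<le> y"
    then have y: "- min s t < y" using x by simp
    have D1: "D (y + 1) = D y - p y" using dd_Digamma_plus1[OF y] by (simp add: D_def p_def)
    have D'1: "D' (y + 1) = D' y + (2 * y + s + t) * (p y)\<^sup>2"
      using dd_Trigamma_plus1[OF y] by (simp add: D'_def p_def power_divide)
    \<comment> \<open>The squares contribute 2 p D - p^2 and the \<open>D'\<close> terms - (2 y + s
      + t) p^2; the common factor p leaves E.\<close>
    have "e * \<Delta> y - e * \<Delta> (y + 1) = p y * (e * E y)"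
      unfolding \<Delta>_def E_def D1 D'1 by (simp add: power2_eq_square algebra_simps)
    moreover have "0 \<le> p y * (e * E y)"
      using ppos[OF y] E_nonneg[OF y] by simp
    ultimately show "e * \<Delta> (y + 1) \<le> e * \<Delta> y" by simp
  next
    have "((\<lambda>y. e * ((D y)\<^sup>2 + D' y)) \<longlongrightarrow> e * (0\<^sup>2 + 0)) at_top"
      by (intro tendsto_intros limD)
    then show "((\<lambda>y. e * \<Delta> y) \<longlongrightarrow> 0) at_top" by (simp add: \<Delta>_def)
  qed
  then show ?thesis by (simp add: \<Delta>_def D_def D'_def)
qed

section \<open>The functions g and f\<close>

text \<open>The integrand of g with the factor 1 / (t - s) taken inside; that it is the derivative
  of g is proved below.\<close>

definition g_prime :: "real \<Rightarrow> real \<Rightarrow> real \<Rightarrow> real \<Rightarrow> real" where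
  "g_prime s t c x =
    (if s \<noteq> t then 1 / (t - s) * ln (Gamma (x + t) / Gamma (x + s) * (Gamma (c + s) / Gamma (c + t)))
     else Digamma (x + s) - Digamma (c + s))"

lemma g_fun_eq_integral: "g_fun s t c x = (LBINT u=c..x. g_prime s t c u)"
  by (simp add: g_fun_def g_prime_def)

lemma has_real_derivative_g_prime:
  assumes c: "- min s t < c" and x: "- min s t < x"
  shows "(g_prime s t c has_real_derivative dd_Polygamma 0 s t x) (at x)"
proof (cases "s = t")
  case True
  have "x + s \<notin> \<int>\<^sub>\<le>\<^sub>0" using x by (auto elim!: nonpos_Ints_cases)
  then show ?thesis using True unfolding g_prime_def dd_Polygamma_def
    by (auto intro!: derivative_eq_intros)
next
  case False
  define K where "K = Gamma (c + s) / Gamma (c + t)"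
  have K: "0 < K" using c by (simp add: K_def)
  \<comment> \<open>All Gamma values on the half-line are positive, so the logarithm splits into
    \<open>ln_Gamma\<close> terms, with derivatives \<open>Digamma\<close>, and a constant.\<close>
  have "((\<lambda>x. 1 / (t - s) * (ln_Gamma (x + t) - ln_Gamma (x + s) + ln K)) has_real_derivative
      dd_Polygamma 0 s t x) (at x)"
    using x False by (auto intro!: derivative_eq_intros simp: dd_Polygamma_def)
  then show ?thesis
  proof (rule has_field_derivative_transform_within_open[where S = "{- min s t<..}"])
    fix y assume "y \<in> {- min s t<..}"
    then have "0 < y + s" "0 < y + t" by auto
    then show "1 / (t - s) * (ln_Gamma (y + t) - ln_Gamma (y + s) + ln K) = g_prime s t c y"
      using False K Gamma_real_pos[of "y + s"] Gamma_real_pos[of "y + t"]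
      unfolding g_prime_def K_def[symmetric]
      by (simp add: ln_Gamma_real_pos ln_mult ln_div del: Gamma_real_pos)
  qed (use x in auto)
qed

lemma g_prime_center:
  assumes "- min s t < c"
  shows "g_prime s t c c = 0"
proof -
  have "Gamma (c + s) \<noteq> 0" "Gamma (c + t) \<noteq> 0"
    using assms Gamma_real_pos[of "c + s"] Gamma_real_pos[of "c + t"] by linarith+
  then show ?thesis by (simp add: g_prime_def)
qed

lemma has_real_derivative_g_fun:
  assumes c: "- min s t < c" and x: "- min s t < x"
  shows "(g_fun s t c has_real_derivative g_prime s t c x) (at x)"
proof -
  \<comment> \<open>The interval [a, b] lies in the half-line and has c and x in its interior, so
    the one-sided form of the derivative within [a, b] is the full derivative at x.\<close>
  define a b where "a = (min c x - min s t) / 2" and "b = max c x + 1"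
  have ab: "- min s t < a" "a < c" "c < b" "a < x" "x < b"
    using c x by (auto simp: a_def b_def min_def max_def)
  have "continuous_on {a..b} (g_prime s t c)"
  proof (intro continuous_at_imp_continuous_on ballI)
    fix y assume "y \<in> {a..b}"
    then have "- min s t < y" using ab(1) by simp
    then show "isCont (g_prime s t c) y"
      by (rule DERIV_isCont[OF has_real_derivative_g_prime[OF c]])
  qed
  then have "((\<lambda>u. LBINT y=c..u. g_prime s t c y) has_vector_derivative g_prime s t c x)
      (at x within {a..b})"
    using ab by (intro interval_integral_FTC2) auto
  moreover have "at x within {a..b} = at x"
    using ab by (intro at_within_interior) auto
  ultimately show ?thesis
    by (simp add: has_real_derivative_iff_has_vector_derivative g_fun_eq_integral[abs_def])
qed

section \<open>Monotonicity of f\<close>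

lemma f_fun_eq:
  assumes c: "- min s t < c" and x: "- min s t < x"
  shows "f_fun s t c x =
    (if x = c then 1 / dd_Polygamma 0 s t c
     else g_fun s t c x / ((g_prime s t c x - 1) * exp (g_prime s t c x) + 1))"
proof -
  have deriv_g: "deriv (g_fun s t c) y = g_prime s t c y" if "- min s t < y" for y
    using has_real_derivative_g_fun[OF c that] by (rule DERIV_imp_deriv)
  \<comment> \<open>\<open>deriv g\<close> is known only on the half-line, but the outer derivative
    at c depends only on values near c.\<close>
  have "\<forall>\<^sub>F y in nhds c. - min s t < y"
    using eventually_nhds_in_open[of "{- min s t<..}" c] c by simp
  then have "deriv (deriv (g_fun s t c)) c = deriv (g_prime s t c) c"
    by (intro deriv_cong_ev) (auto elim!: eventually_mono simp: deriv_g)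
  also have "\<dots> = dd_Polygamma 0 s t c"
    using has_real_derivative_g_prime[OF c c] by (rule DERIV_imp_deriv)
  finally show ?thesis using deriv_g[OF x] by (simp add: f_fun_def Let_def)
qed

text \<open>The sign \<open>e\<close> is \<open>1\<close> for \<open>\<bar>s - t\<bar> < 1\<close> and \<open>-1\<close> for \<open>\<bar>s - t\<bar> > 1\<close>.\<close>

lemma antimono_on_signed_f_fun:
  fixes e :: real
  assumes c: "- min s t < c" and e: "0 \<le> e * (1 - (s - t)\<^sup>2)"
  shows "antimono_on {- min s t<..} (\<lambda>x. e * f_fun s t c x)"
proof -
  define D where "D = dd_Polygamma 0 s t"
  define \<phi> where "\<phi> = g_prime s t c"
  define R where "R x = D x * exp (\<phi> x)" for x
  have dphi: "(\<phi> has_real_derivative D x) (at x)" if "- min s t < x" for x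
    unfolding \<phi>_def D_def by (rule has_real_derivative_g_prime[OF c that])
  have Dpos: "0 < D x" if "- min s t < x" for x
    using dd_Digamma_pos[OF that] by (simp add: D_def)
  have Rpos: "0 < R x" if "- min s t < x" for x
    using Dpos[OF that] by (simp add: R_def)
  have R_mono: "e * R x \<le> e * R y" if xy: "- min s t < x" "x \<le> y" for x y
  proof (rule DERIV_nonneg_imp_nondecreasing[OF xy(2)])
    fix u assume "x \<le> u" "u \<le> y"
    then have u: "- min s t < u" using xy by simp
    have "((\<lambda>u. e * R u) has_real_derivative
        e * ((D u)\<^sup>2 + dd_Polygamma 1 s t u) * exp (\<phi> u)) (at u)"
      unfolding R_def
      using dphi[OF u] has_real_derivative_dd_Polygamma[OF u, of 0]
      by (auto intro!: derivative_eq_intros simp: D_def[symmetric] power2_eq_square algebra_simps)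
    moreover have "0 \<le> e * ((D u)\<^sup>2 + dd_Polygamma 1 s t u) * exp (\<phi> u)"
      using dd_Digamma_sq_plus_deriv_sign[OF u e] by (simp add: D_def)
    ultimately show "\<exists>z. ((\<lambda>u. e * R u) has_real_derivative z) (at u) \<and> 0 \<le> z" by blast
  qed
  have phi_c: "\<phi> c = 0" using g_prime_center[OF c] by (simp add: \<phi>_def)
  \<comment> \<open>Being strictly increasing with \<phi> c = 0, \<phi> has the sign of x - c, and
    so has the derivative \<phi> R of the denominator.\<close>
  have phi_less: "\<phi> x < \<phi> y" if "- min s t < x" "x < y" for x y
  proof (rule DERIV_pos_imp_increasing[OF that(2)])
    fix u assume "x \<le> u"
    then have "- min s t < u" using that(1) by simp
    then show "\<exists>d. (\<phi> has_real_derivative d) (at u) \<and> 0 < d"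
      using dphi Dpos by blast
  qed
  have anti: "antimono_on {- min s t<..}
      (\<lambda>x. if x = c then e / R c else e * g_fun s t c x / ((\<phi> x - 1) * exp (\<phi> x) + 1))"
  \<comment> \<open>The numerator e g has derivative e \<phi> = (e / R) (\<phi> R), so r = e / R; it
    decreases because e R increases and R > 0.\<close>
  proof (rule antimono_on_quotient[where r = "\<lambda>x. e / R x" and g' = "\<lambda>x. \<phi> x * R x"])
    fix x assume "x \<in> {- min s t<..}"
    then have x: "- min s t < x" by simp
    show "((\<lambda>x. e * g_fun s t c x) has_real_derivative e / R x * (\<phi> x * R x)) (at x)"
      using has_real_derivative_g_fun[OF c x] Rpos[OF x]
      by (auto intro!: derivative_eq_intros simp: \<phi>_def)
    show "((\<lambda>x. (\<phi> x - 1) * exp (\<phi> x) + 1) has_real_derivative \<phi> x * R x) (at x)"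
      using dphi[OF x] by (auto intro!: derivative_eq_intros simp: R_def algebra_simps)
    show "0 < \<phi> x * R x" if "c < x"
      using phi_less[OF c that] phi_c Rpos[OF x] by simp
    show "\<phi> x * R x < 0" if "x < c"
      using phi_less[OF x that] phi_c Rpos[OF x] by (simp add: mult_less_0_iff)
  next
    show "antimono_on {- min s t<..} (\<lambda>x. e / R x)"
    proof (rule monotone_onI)
      fix x y assume "x \<in> {- min s t<..}" "y \<in> {- min s t<..}" "x \<le> y"
      then have "0 < R x" "0 < R y" "e * R x \<le> e * R y" using Rpos R_mono by auto
      then show "e / R y \<le> e / R x" by (simp add: field_simps)
    qed
  qed (use c phi_c in \<open>auto simp: g_fun_eq_integral is_interval_1\<close>)
  \<comment> \<open>At c the values agree because \<phi> c = 0 gives R c = D c.\<close>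
  have eq: "e * f_fun s t c x =
      (if x = c then e / R c else e * g_fun s t c x / ((\<phi> x - 1) * exp (\<phi> x) + 1))"
    if "x \<in> {- min s t<..}" for x
    using f_fun_eq[OF c, of x] that phi_c by (simp add: \<phi>_def D_def R_def)
  show ?thesis
  proof (rule monotone_onI)
    fix x y assume xy: "x \<in> {- min s t<..}" "y \<in> {- min s t<..}" "x \<le> y"
    show "e * f_fun s t c y \<le> e * f_fun s t c x"
      unfolding eq[OF xy(1)] eq[OF xy(2)] using monotone_onD[OF anti xy] .
  qed
qed

theorem theorem5:
  fixes s t c :: real
  assumes "c > - min s t"
  shows "(\<bar>s - t\<bar> < 1 \<longrightarrow> antimono_on {- min s t<..} (f_fun s t c)) \<and>
         (\<bar>s - t\<bar> > 1 \<longrightarrow> mono_on {- min s t<..} (f_fun s t c))"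
proof (intro conjI impI)
  assume "\<bar>s - t\<bar> < 1"
  then have "(s - t)\<^sup>2 \<le> 1" by (simp add: abs_square_le_1)
  then show "antimono_on {- min s t<..} (f_fun s t c)"
    using antimono_on_signed_f_fun[OF assms, of 1] by simp
next
  assume "\<bar>s - t\<bar> > 1"
  then have "1 \<le> (s - t)\<^sup>2" using abs_square_less_1[of "s - t"] by linarith
  then show "mono_on {- min s t<..} (f_fun s t c)"
    using antimono_on_signed_f_fun[OF assms, of "-1"] by (simp add: monotone_on_def)
qed

end
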